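(* Let $0<p<\infty$, $\beta\ge0$, and let $\{\psi(n)\}_{n\in\mathbb Z^+}$ be a non-negative sequence for which there is a constant $c>0$ with $$\sum_{k=1}^n\psi(k)\le c\sum_{k=n}^{2n}\psi(k)\quad\text{for all } n\in\mathbb Z^+.$$ Let $\{v(n)\}_{n\in\mathbb Z^+}$ be a weight sequence. Then there is a constant $C>0$ such that $$\sum_{n=1}^\infty(\mathcal A_\psi y)^p(n)\,v(n)\le C\sum_{n=1}^\infty y^p(n)\,v(n)$$ holds for all non-negative sequences $\{y(n)\}_{n\in\mathbb Z^+}\in\mathcal Q_\beta$ if and only if there is a constant $C>0$ (possibly different) such that $$\left(\sum_{k=1}^n k^\beta\psi(k)\right)^p\sum_{k=n}^\infty\Psi^{-p}(k)\,v(k)\le C\sum_{k=1}^n k^{\beta p}v(k)\quad\text{for all } n\in\mathbb Z^+.$$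
   Context: $\mathbb Z^+=\{1,2,3,\dots\}$. A weight sequence is a non-negative sequence of real numbers indexed by $\mathbb Z^+$. All series of non-negative terms take values in $[0,\infty]$. For $\beta\ge-1$, a sequence $\{y(k)\}_{k\in\mathbb Z^+}$ belongs to $\mathcal Q_\beta$ (quasi non-increasing sequences) if $\{k^{-\beta}y(k)\}_{k\in\mathbb Z^+}$ is non-increasing. For a non-negative sequence $\psi$, put $\Psi(k)=\sum_{\tau=1}^k\psi(\tau)$. The discrete generalized Hardy averaging operator is $$(\mathcal A_\psi y)(k)=\frac1{\Psi(k)}\sum_{\tau=1}^k y(\tau)\psi(\tau)$$ for non-negative sequences $y$. It is assumed that $\Psi(k)>0$ for all $k$ (i.e. $\psi(1)>0$), so that this is well defined. *)

theory Defs
  imports "HOL-Analysis.Analysis"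
begin

text \<open>
  A sequence indexed by the positive integers is a function \<open>nat \<Rightarrow> real\<close> whose value at \<open>0\<close>
  is ignored.
\<close>

definition nonneg_seq :: "(nat \<Rightarrow> real) \<Rightarrow> bool" where
  "nonneg_seq y \<longleftrightarrow> (\<forall>k\<ge>1. 0 \<le> y k)"

text \<open>
  Non-negativity is not part of the class; it is required separately where needed.
\<close>

definition quasi_nonincreasing :: "real \<Rightarrow> (nat \<Rightarrow> real) set" where
  "quasi_nonincreasing \<beta> = {y. antimono_on {1..} (\<lambda>k. real k powr (- \<beta>) * y k)}"

definition partial_sum :: "(nat \<Rightarrow> real) \<Rightarrow> nat \<Rightarrow> real" where
  "partial_sum \<psi> k = (\<Sum>\<tau>=1..k. \<psi> \<tau>)"

definition hardy_avg :: "(nat \<Rightarrow> real) \<Rightarrow> (nat \<Rightarrow> real) \<Rightarrow> nat \<Rightarrow> real" where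
  "hardy_avg \<psi> y k = (1 / partial_sum \<psi> k) * (\<Sum>\<tau>=1..k. y \<tau> * \<psi> \<tau>)"

text \<open>
  The series of \<open>f k\<close> over all \<open>k \<ge> n\<close>, with value in \<open>[0, \<infinity>]\<close>; the terms \<open>f k\<close> have to be
  non-negative, since \<^const>\<open>ennreal\<close> sends negative reals to \<open>0\<close>.
\<close>

definition series_from :: "nat \<Rightarrow> (nat \<Rightarrow> real) \<Rightarrow> ennreal" where
  "series_from n f = (\<Sum>j. ennreal (f (n + j)))"

end

theory Submission
  imports Defs
begin

text \<open>
  Put \<open>w k = k\<^sup>\<beta> \<psi> k\<close>, \<open>W = partial_sum w\<close>, \<open>a k = \<Psi>(k)\<^sup>-\<^sup>p v k\<close> and \<open>u k = k\<^sup>\<beta>\<^sup>p v k\<close>. Writing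
  \<open>y k = k\<^sup>\<beta> z k\<close>, the members of the class correspond to the non-increasing \<open>z\<close>, and the
  Hardy inequality becomes \<open>\<Sum> S\<^sup>p a \<le> C \<Sum> z\<^sup>p u\<close> with \<open>S = partial_sum (z w)\<close>. The condition on the
  weights reads \<open>W(n)\<^sup>p \<Sum>\<^bsub>k\<ge>n\<^esub> a k \<le> C \<Sum>\<^bsub>k\<le>n\<^esub> u k\<close>; it is the Hardy inequality tested on the
  indicator functions of \<open>{1..n}\<close> with the left side cut down to \<open>k \<ge> n\<close>, hence necessary.

  For sufficiency, the increments of \<open>S\<^sup>p\<close> are at most a constant times
  \<open>z S\<^sup>p\<^sup>-\<^sup>1 w\<close>, which is at most a constant times \<open>g\<close> times the increment of \<open>W\<^sup>p\<close>, where
  \<open>g = z (S/W)\<^sup>p\<^sup>-\<^sup>1\<close> if \<open>p \<ge> 1\<close> and \<open>g = z\<^sup>p\<close> if \<open>p < 1\<close>. In both cases \<open>g\<close> is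
  non-increasing, because averages of a non-increasing sequence are non-increasing. Summing over
  \<open>n\<close> and exchanging the summations gives
  \<open>\<Sum> S\<^sup>p a \<le> C \<Sum> g(\<tau>) (W(\<tau>)\<^sup>p - W(\<tau>-1)\<^sup>p) \<Sum>\<^bsub>n\<ge>\<tau>\<^esub> a n\<close>.
  Since \<open>g\<close> is non-increasing, the weight multiplying \<open>g\<close> may be replaced by any other weight with
  larger partial sums (\<open>sum_mult_antimono_le\<close>), and an Abel summation together with the condition
  shows that a multiple of \<open>u\<close> is such a weight (\<open>sum_increment_tail_le\<close>). So
  \<open>\<Sum> S\<^sup>p a \<le> C \<Sum> g u\<close>.

  For \<open>p < 1\<close> this is the claim. For \<open>p \<ge> 1\<close>, Young's inequality splits \<open>g u\<close> into a large multiple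
  of \<open>z\<^sup>p u\<close> and a small multiple of \<open>(S/W)\<^sup>p u\<close>. The latter can be absorbed in the left side as soon
  as \<open>u \<le> L W\<^sup>p a\<close>, that is \<open>k\<^sup>\<beta> \<Psi>(k) \<le> L' W(k)\<close>. This is where the growth hypothesis on \<open>\<psi>\<close>
  enters: a fixed fraction of \<open>\<Psi>(n)\<close> comes from the indices in \<open>[n/3, n]\<close>, where \<open>k\<^sup>\<beta>\<close> is
  comparable to \<open>n\<^sup>\<beta>\<close> (\<open>power_weighted_partial_sum_ge\<close>).
  All of this is done with finite sums, which makes the absorption legitimate.
\<close>

section \<open>Increments of powers\<close>

lemma powr_increment_bounds:
  fixes p x y :: real
  assumes "p > 0" "0 \<le> x" "x \<le> y"
  shows "min 1 p * ((y - x) * y powr (p - 1)) \<le> y powr p - x powr p"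
    and "y powr p - x powr p \<le> max 1 p * ((y - x) * y powr (p - 1))"
proof -
  have split: "t powr p = t * t powr (p - 1)" if "t \<ge> 0" for t :: real
    using that powr_mult_base[of t "p - 1"] by simp
  have "min 1 p * ((y - x) * y powr (p - 1)) \<le> y powr p - x powr p \<and>
        y powr p - x powr p \<le> max 1 p * ((y - x) * y powr (p - 1))"
  proof (cases "x = 0 \<or> x = y")
    case True
    then show ?thesis
    proof
      assume "x = 0"
      have "min 1 p * (y * y powr (p - 1)) \<le> 1 * (y * y powr (p - 1))"
        "1 * (y * y powr (p - 1)) \<le> max 1 p * (y * y powr (p - 1))"
        using assms by (intro mult_right_mono; simp)+
      then show ?thesis using \<open>x = 0\<close> assms split[of y] by simp
    qed simp
  next
    case False
    then have xy: "0 < x" "x < y" using assms by auto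
    obtain t where t: "x < t" "t < y" "y powr p - x powr p = (y - x) * (p * t powr (p - 1))"
    proof -
      have "((\<lambda>t. t powr p) has_real_derivative p * t powr (p - 1)) (at t)" if "x \<le> t" for t
        using that xy by (intro has_real_derivative_powr) auto
      then show thesis
        using MVT2[of x y "\<lambda>t. t powr p" "\<lambda>t. p * t powr (p - 1)"] xy that by auto
    qed
    show ?thesis
    proof (cases "p \<ge> 1")
      case True
      have "t powr (p - 1) \<le> y powr (p - 1)" "x powr (p - 1) \<le> y powr (p - 1)"
        using t xy True by (auto intro!: powr_mono2)
      then have "(y - x) * (p * t powr (p - 1)) \<le> (y - x) * (p * y powr (p - 1))"
        "x * x powr (p - 1) \<le> x * y powr (p - 1)"
        using xy assms by (auto intro!: mult_left_mono)
      then show ?thesis using t(3) split[of x] split[of y] xy True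
        by (simp add: algebra_simps max_def min_def)
    next
      case False
      have "t powr (p - 1) \<ge> y powr (p - 1)" "x powr (p - 1) \<ge> y powr (p - 1)"
        using t xy False by (auto intro!: powr_mono2')
      then have "(y - x) * (p * t powr (p - 1)) \<ge> (y - x) * (p * y powr (p - 1))"
        "x * x powr (p - 1) \<ge> x * y powr (p - 1)"
        using xy assms by (auto intro!: mult_left_mono)
      then show ?thesis using t(3) split[of x] split[of y] xy False
        by (simp add: algebra_simps max_def min_def)
    qed
  qed
  then show "min 1 p * ((y - x) * y powr (p - 1)) \<le> y powr p - x powr p"
    and "y powr p - x powr p \<le> max 1 p * ((y - x) * y powr (p - 1))" by auto
qed

text \<open>
  Young's inequality without its sharp constant: if \<open>z \<le> \<delta> s\<close> the first term on the right
  alone suffices, otherwise \<open>s < z / \<delta>\<close> and the second one does.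
\<close>

lemma mult_powr_le_weighted_sum:
  fixes p z s \<delta> :: real
  assumes "p \<ge> 1" "z \<ge> 0" "s \<ge> 0" "\<delta> > 0"
  shows "z * s powr (p - 1) \<le> \<delta> * s powr p + \<delta> powr (1 - p) * z powr p"
proof (cases "z \<le> \<delta> * s")
  case True
  have "z * s powr (p - 1) \<le> \<delta> * s * s powr (p - 1)"
    using True by (intro mult_right_mono) auto
  also have "\<dots> = \<delta> * s powr p"
    using powr_mult_base[of s "p - 1"] assms by simp
  finally show ?thesis by (simp add: add_increasing2)
next
  case False
  then have "s \<le> z / \<delta>" using assms by (simp add: field_simps)
  then have "z * s powr (p - 1) \<le> z * (z / \<delta>) powr (p - 1)"
    using assms by (intro mult_left_mono powr_mono2) auto
  also have "\<dots> = \<delta> powr (1 - p) * (z * z powr (p - 1))"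
    using powr_minus_divide[of \<delta> "p - 1"] by (simp add: powr_divide)
  also have "\<dots> = \<delta> powr (1 - p) * z powr p"
    using powr_mult_base[of z "p - 1"] assms by simp
  finally show ?thesis using assms by (simp add: add_increasing)
qed

section \<open>Finite sums with monotone factors\<close>

lemma partial_sum_0 [simp]: "partial_sum f 0 = 0"
  by (simp add: partial_sum_def)

lemma partial_sum_Suc [simp]: "partial_sum f (Suc n) = partial_sum f n + f (Suc n)"
  by (simp add: partial_sum_def)

lemma partial_sum_nonneg:
  assumes "\<And>k. k \<ge> 1 \<Longrightarrow> f k \<ge> 0"
  shows "partial_sum f n \<ge> 0"
  unfolding partial_sum_def using assms by (intro sum_nonneg) auto

text \<open>
  For non-increasing \<open>g\<close> an inequality between sums weighted by \<open>g\<close> has to be checked only on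
  initial segments: \<open>g\<close> is a non-negative combination of indicator functions of such segments.
\<close>

lemma sum_mult_antimono_le:
  fixes g x x' :: "nat \<Rightarrow> real"
  assumes g0: "\<And>k. k \<ge> 1 \<Longrightarrow> g k \<ge> 0"
    and g: "\<And>k. k \<ge> 1 \<Longrightarrow> g (Suc k) \<le> g k"
    and le: "\<And>n. n \<le> m \<Longrightarrow> (\<Sum>k=1..n. x k) \<le> (\<Sum>k=1..n. x' k)"
  shows "(\<Sum>k=1..m. g k * x k) \<le> (\<Sum>k=1..m. g k * x' k)"
proof -
  define d where "d k = x' k - x k" for k
  have pos: "(\<Sum>k=1..n. d k) \<ge> 0" if "n \<le> m" for n
    using le[OF that] by (simp add: d_def sum_subtractf)
  have main: "(\<Sum>k=1..n. g k * d k) \<ge> g n * (\<Sum>k=1..n. d k)" if "n \<le> m" for n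
    using that
  proof (induction n)
    case (Suc n)
    have "g (Suc n) * (\<Sum>k=1..n. d k) \<le> g n * (\<Sum>k=1..n. d k)"
    proof (cases "n = 0")
      case False
      then show ?thesis using g[of n] pos[of n] Suc by (intro mult_right_mono) auto
    qed simp
    then show ?case using Suc by (simp add: algebra_simps)
  qed simp
  have "g m * (\<Sum>k=1..m. d k) \<ge> 0"
    using g0[of m] pos[of m] by (cases "m = 0") auto
  then have "0 \<le> (\<Sum>k=1..m. g k * d k)" using main[of m] by linarith
  then show ?thesis by (simp add: d_def algebra_simps sum_subtractf)
qed

lemma sum_triangle_swap:
  fixes a h :: "nat \<Rightarrow> real"
  shows "(\<Sum>n=1..m. a n * (\<Sum>\<tau>=1..n. h \<tau>)) = (\<Sum>\<tau>=1..m. h \<tau> * (\<Sum>n=\<tau>..m. a n))"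
proof (induction m)
  case (Suc m)
  have "(\<Sum>\<tau>=1..m. h \<tau> * (\<Sum>n=\<tau>..Suc m. a n))
      = (\<Sum>\<tau>=1..m. h \<tau> * (\<Sum>n=\<tau>..m. a n) + h \<tau> * a (Suc m))"
    by (intro sum.cong) (auto simp: algebra_simps)
  then show ?case using Suc
    by (simp add: sum.distrib sum_distrib_left sum_distrib_right algebra_simps)
qed simp

text \<open>
  Abel summation moves the increments of \<open>Q\<close> onto the tails of \<open>a\<close>, leaving a boundary term
  \<open>Q n * (\<Sum>k=n+1..m. a k)\<close> that the hypothesis on the tails controls.
\<close>

lemma sum_increment_tail_le:
  fixes Q a u :: "nat \<Rightarrow> real"
  assumes Q0: "Q 0 = 0" and Qnn: "\<And>k. Q k \<ge> 0"
    and a: "\<And>k. k \<ge> 1 \<Longrightarrow> a k \<ge> 0"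
    and u: "\<And>k. k \<ge> 1 \<Longrightarrow> Q k * a k \<le> u k"
    and tail: "\<And>n. 1 \<le> n \<Longrightarrow> n \<le> m \<Longrightarrow> Q n * (\<Sum>k=n..m. a k) \<le> C * (\<Sum>k=1..n. u k)"
    and n: "n \<le> m"
  shows "(\<Sum>\<tau>=1..n. (Q \<tau> - Q (\<tau> - 1)) * (\<Sum>k=\<tau>..m. a k)) \<le> (C + 1) * (\<Sum>k=1..n. u k)"
proof (cases "n = 0")
  case False
  have abel: "(\<Sum>\<tau>=1..n. (Q \<tau> - Q (\<tau> - 1)) * (\<Sum>k=\<tau>..m. a k))
      = Q n * (\<Sum>k=Suc n..m. a k) + (\<Sum>\<tau>=1..n. Q \<tau> * a \<tau>)"
    using n
  proof (induction n)
    case (Suc n)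
    have "(\<Sum>k=Suc n..m. a k) = a (Suc n) + (\<Sum>k=Suc (Suc n)..m. a k)"
      using Suc.prems by (simp add: sum.atLeast_Suc_atMost)
    then show ?case using Suc by (simp add: algebra_simps)
  qed (simp add: Q0)
  have "(\<Sum>k=Suc n..m. a k) \<le> (\<Sum>k=n..m. a k)"
    using False a by (intro sum_mono2) auto
  then have "Q n * (\<Sum>k=Suc n..m. a k) \<le> Q n * (\<Sum>k=n..m. a k)"
    using Qnn by (intro mult_left_mono)
  also have "\<dots> \<le> C * (\<Sum>k=1..n. u k)" using tail[of n] False n by simp
  finally have 1: "Q n * (\<Sum>k=Suc n..m. a k) \<le> C * (\<Sum>k=1..n. u k)" .
  have "(\<Sum>\<tau>=1..n. Q \<tau> * a \<tau>) \<le> (\<Sum>k=1..n. u k)"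
    using u by (intro sum_mono) auto
  then show ?thesis using abel 1 by (simp add: algebra_simps)
qed simp

section \<open>The Hardy inequality for non-increasing sequences\<close>

lemma partial_sum_mult_antimono_ge:
  fixes w z :: "nat \<Rightarrow> real"
  assumes w: "\<And>k. k \<ge> 1 \<Longrightarrow> w k \<ge> 0"
    and z: "\<And>k l. 1 \<le> k \<Longrightarrow> k \<le> l \<Longrightarrow> z l \<le> z k"
    and "n \<le> l" "1 \<le> l"
  shows "z l * partial_sum w n \<le> partial_sum (\<lambda>k. z k * w k) n"
  unfolding partial_sum_def sum_distrib_left
  using assms by (intro sum_mono mult_right_mono) auto

lemma weighted_average_antimono:
  fixes w z :: "nat \<Rightarrow> real"
  assumes w: "\<And>k. k \<ge> 1 \<Longrightarrow> w k \<ge> 0"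
    and W: "\<And>k. k \<ge> 1 \<Longrightarrow> partial_sum w k > 0"
    and z: "\<And>k l. 1 \<le> k \<Longrightarrow> k \<le> l \<Longrightarrow> z l \<le> z k"
    and n: "n \<ge> 1"
  shows "partial_sum (\<lambda>k. z k * w k) (Suc n) / partial_sum w (Suc n)
       \<le> partial_sum (\<lambda>k. z k * w k) n / partial_sum w n"
proof -
  have "z (Suc n) * partial_sum w n \<le> partial_sum (\<lambda>k. z k * w k) n"
    using partial_sum_mult_antimono_ge[of w z n "Suc n"] w z by simp
  then have "w (Suc n) * (z (Suc n) * partial_sum w n)
      \<le> w (Suc n) * partial_sum (\<lambda>k. z k * w k) n"
    using w[of "Suc n"] by (intro mult_left_mono) auto
  then show ?thesis using W[of n] W[of "Suc n"] n
    by (simp add: divide_simps) (simp add: algebra_simps)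
qed

text \<open>
  The non-increasing sequence \<open>g\<close> that linearises \<open>S\<^sup>p\<close>: up to constants the increments of \<open>S\<^sup>p\<close> are
  bounded by \<open>g\<close> times the increments of \<open>W\<^sup>p\<close>. For \<open>p \<ge> 1\<close> the power \<open>S\<^sup>p\<^sup>-\<^sup>1\<close> is kept, for \<open>p < 1\<close>
  it is estimated by \<open>S \<ge> z W\<close>; each choice keeps \<open>g\<close> monotone.
\<close>

definition linearizer :: "real \<Rightarrow> (nat \<Rightarrow> real) \<Rightarrow> (nat \<Rightarrow> real) \<Rightarrow> nat \<Rightarrow> real" where
  "linearizer p w z k =
     (if p \<ge> 1 then z k * (partial_sum (\<lambda>k. z k * w k) k / partial_sum w k) powr (p - 1)
      else z k powr p)"

lemma linearizer_nonneg: "z k \<ge> 0 \<Longrightarrow> linearizer p w z k \<ge> 0"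
  by (simp add: linearizer_def)

lemma linearizer_antimono:
  fixes w z :: "nat \<Rightarrow> real"
  assumes p: "p > 0"
    and w: "\<And>k. k \<ge> 1 \<Longrightarrow> w k \<ge> 0"
    and W: "\<And>k. k \<ge> 1 \<Longrightarrow> partial_sum w k > 0"
    and z0: "\<And>k. k \<ge> 1 \<Longrightarrow> z k \<ge> 0"
    and z: "\<And>k l. 1 \<le> k \<Longrightarrow> k \<le> l \<Longrightarrow> z l \<le> z k"
    and n: "n \<ge> 1"
  shows "linearizer p w z (Suc n) \<le> linearizer p w z n"
proof -
  have "partial_sum (\<lambda>k. z k * w k) (Suc n) \<ge> 0"
    by (rule partial_sum_nonneg) (simp add: w z0)
  then have "partial_sum (\<lambda>k. z k * w k) (Suc n) / partial_sum w (Suc n) \<ge> 0"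
    using W[of "Suc n"] by (intro divide_nonneg_pos) auto
  then show ?thesis
    using weighted_average_antimono[of w z n, OF w W z n] z[of n "Suc n"] z0[of n] z0[of "Suc n"] n p
    unfolding linearizer_def by (auto intro!: mult_mono powr_mono2)
qed

lemma powr_partial_sum_increment_le:
  fixes w z :: "nat \<Rightarrow> real"
  assumes p: "p > 0"
    and w: "\<And>k. k \<ge> 1 \<Longrightarrow> w k \<ge> 0"
    and W: "\<And>k. k \<ge> 1 \<Longrightarrow> partial_sum w k > 0"
    and z0: "\<And>k. k \<ge> 1 \<Longrightarrow> z k \<ge> 0"
    and z: "\<And>k l. 1 \<le> k \<Longrightarrow> k \<le> l \<Longrightarrow> z l \<le> z k"
  shows "partial_sum (\<lambda>k. z k * w k) (Suc n) powr p - partial_sum (\<lambda>k. z k * w k) n powr p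
       \<le> max 1 p / min 1 p *
          (linearizer p w z (Suc n) * (partial_sum w (Suc n) powr p - partial_sum w n powr p))"
proof -
  define S where "S = partial_sum (\<lambda>k. z k * w k)"
  let ?W = "partial_sum w" and ?g = "linearizer p w z (Suc n)"
  have S0: "S k \<ge> 0" for k
    unfolding S_def by (rule partial_sum_nonneg) (simp add: w z0)
  have wz: "w (Suc n) \<ge> 0" "z (Suc n) \<ge> 0" using w z0 by auto
  have Wn: "?W n \<ge> 0" by (rule partial_sum_nonneg) (rule w)
  have WS: "?W (Suc n) > 0" using W[of "Suc n"] by simp
  have SS: "S (Suc n) = S n + z (Suc n) * w (Suc n)" by (simp add: S_def)
  have key: "z (Suc n) * S (Suc n) powr (p - 1) \<le> ?g * ?W (Suc n) powr (p - 1)"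
  proof (cases "p \<ge> 1")
    case True
    then show ?thesis using WS by (simp add: linearizer_def S_def powr_divide)
  next
    case False
    have ge: "z (Suc n) * ?W (Suc n) \<le> S (Suc n)"
      unfolding S_def by (rule partial_sum_mult_antimono_ge) (use w z in auto)
    show ?thesis
    proof (cases "z (Suc n) = 0")
      case zpos: False
      then have "z (Suc n) * ?W (Suc n) > 0" using wz WS by simp
      then have "S (Suc n) powr (p - 1) \<le> (z (Suc n) * ?W (Suc n)) powr (p - 1)"
        using ge False by (intro powr_mono2') auto
      then have "z (Suc n) * S (Suc n) powr (p - 1)
          \<le> z (Suc n) * (z (Suc n) * ?W (Suc n)) powr (p - 1)"
        using wz by (intro mult_left_mono)
      also have "\<dots> = z (Suc n) * z (Suc n) powr (p - 1) * ?W (Suc n) powr (p - 1)"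
        by (simp add: powr_mult)
      also have "z (Suc n) * z (Suc n) powr (p - 1) = ?g"
        using powr_mult_base[of "z (Suc n)" "p - 1"] wz False by (simp add: linearizer_def)
      finally show ?thesis .
    qed (simp add: linearizer_nonneg)
  qed
  have g0: "?g \<ge> 0" using wz by (simp add: linearizer_nonneg)
  have "S (Suc n) powr p - S n powr p
      \<le> max 1 p * ((S (Suc n) - S n) * S (Suc n) powr (p - 1))"
    using p S0 SS wz by (intro powr_increment_bounds) auto
  also have "\<dots> = max 1 p * (w (Suc n) * (z (Suc n) * S (Suc n) powr (p - 1)))"
    by (simp add: SS)
  also have "\<dots> \<le> max 1 p * (w (Suc n) * (?g * ?W (Suc n) powr (p - 1)))"
    using key wz by (intro mult_left_mono) auto
  also have "\<dots> = max 1 p / min 1 p *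
      (?g * (min 1 p * ((?W (Suc n) - ?W n) * ?W (Suc n) powr (p - 1))))"
    using p by simp
  also have "\<dots> \<le> max 1 p / min 1 p * (?g * (?W (Suc n) powr p - ?W n powr p))"
    using p g0 Wn wz by (intro mult_left_mono powr_increment_bounds) auto
  finally show ?thesis unfolding S_def .
qed

text \<open>
  The sufficiency argument up to the point where the term with \<open>(S/W)\<^sup>p\<^sup>-\<^sup>1\<close> has to be absorbed.
  Only finite sums occur, so that this later step is a subtraction of real numbers.
\<close>

lemma hardy_sum_le_linearizer_sum:
  fixes w z a u :: "nat \<Rightarrow> real"
  assumes p: "p > 0" and C: "C > 0"
    and w: "\<And>k. k \<ge> 1 \<Longrightarrow> w k \<ge> 0"
    and W: "\<And>k. k \<ge> 1 \<Longrightarrow> partial_sum w k > 0"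
    and a: "\<And>k. k \<ge> 1 \<Longrightarrow> a k \<ge> 0"
    and u: "\<And>k. k \<ge> 1 \<Longrightarrow> partial_sum w k powr p * a k \<le> u k"
    and tail: "\<And>n. 1 \<le> n \<Longrightarrow> n \<le> m \<Longrightarrow>
        partial_sum w n powr p * (\<Sum>k=n..m. a k) \<le> C * (\<Sum>k=1..n. u k)"
    and z0: "\<And>k. k \<ge> 1 \<Longrightarrow> z k \<ge> 0"
    and z: "\<And>k l. 1 \<le> k \<Longrightarrow> k \<le> l \<Longrightarrow> z l \<le> z k"
  shows "(\<Sum>n=1..m. partial_sum (\<lambda>k. z k * w k) n powr p * a n)
       \<le> max 1 p / min 1 p * (C + 1) * (\<Sum>k=1..m. linearizer p w z k * u k)"
proof -
  define Q where "Q k = partial_sum w k powr p" for k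
  define D where "D \<tau> = (\<Sum>k=\<tau>..m. a k)" for \<tau>
  let ?\<mu> = "max 1 p / min 1 p" and ?g = "linearizer p w z"
  let ?S = "partial_sum (\<lambda>k. z k * w k)"
  have \<mu>: "?\<mu> \<ge> 0" using p by simp
  have tele: "?S n powr p \<le> ?\<mu> * (\<Sum>\<tau>=1..n. ?g \<tau> * (Q \<tau> - Q (\<tau> - 1)))" for n
  proof (induction n)
    case (Suc n)
    then show ?case
      using powr_partial_sum_increment_le[of p w z n, OF p w W z0 z]
      by (simp add: Q_def algebra_simps del: partial_sum_Suc)
  qed (simp add: p)
  have "(\<Sum>n=1..m. ?S n powr p * a n)
      \<le> (\<Sum>n=1..m. ?\<mu> * (a n * (\<Sum>\<tau>=1..n. ?g \<tau> * (Q \<tau> - Q (\<tau> - 1)))))"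
  proof (rule sum_mono)
    fix n assume "n \<in> {1..m}"
    then have "a n \<ge> 0" using a by simp
    from mult_right_mono[OF tele[of n] this]
    show "?S n powr p * a n \<le> ?\<mu> * (a n * (\<Sum>\<tau>=1..n. ?g \<tau> * (Q \<tau> - Q (\<tau> - 1))))"
      by (simp add: mult_ac)
  qed
  also have "\<dots> = ?\<mu> * (\<Sum>\<tau>=1..m. ?g \<tau> * ((Q \<tau> - Q (\<tau> - 1)) * D \<tau>))"
    unfolding sum_distrib_left[symmetric] sum_triangle_swap D_def by (simp add: mult.assoc)
  also have "\<dots> \<le> ?\<mu> * (\<Sum>\<tau>=1..m. ?g \<tau> * ((C + 1) * u \<tau>))"
  proof (intro mult_left_mono sum_mult_antimono_le \<mu>)
    fix n assume "n \<le> m"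
    then have "(\<Sum>\<tau>=1..n. (Q \<tau> - Q (\<tau> - 1)) * D \<tau>) \<le> (C + 1) * (\<Sum>k=1..n. u k)"
      unfolding D_def by (intro sum_increment_tail_le) (use a u tail p in \<open>auto simp: Q_def\<close>)
    then show "(\<Sum>\<tau>=1..n. (Q \<tau> - Q (\<tau> - 1)) * D \<tau>) \<le> (\<Sum>k=1..n. (C + 1) * u k)"
      by (simp add: sum_distrib_left)
  qed (use z0 linearizer_antimono[of p w z, OF p w W z0 z] in \<open>auto intro: linearizer_nonneg\<close>)
  also have "\<dots> = ?\<mu> * (C + 1) * (\<Sum>k=1..m. ?g k * u k)"
    by (simp add: sum_distrib_left mult_ac)
  finally show ?thesis .
qed

text \<open>
  Depends only on \<open>p\<close>, \<open>C\<close> and \<open>L\<close>, hence is uniform in the length of the finite sums and in \<open>z\<close>.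
  The factor \<open>2\<close> and the power for \<open>p \<ge> 1\<close> are the price of the absorption.
\<close>

definition hardy_constant :: "real \<Rightarrow> real \<Rightarrow> real \<Rightarrow> real" where
  "hardy_constant p C L =
     (let M = max 1 p / min 1 p * (C + 1)
      in if p \<ge> 1 then 2 * M * (1 / (2 * M * L)) powr (1 - p) else M)"

lemma hardy_constant_pos: "p > 0 \<Longrightarrow> C > 0 \<Longrightarrow> L > 0 \<Longrightarrow> hardy_constant p C L > 0"
  by (auto simp: hardy_constant_def Let_def intro!: mult_pos_pos divide_pos_pos)

lemma finite_hardy_inequality:
  fixes w z a u :: "nat \<Rightarrow> real"
  assumes p: "p > 0" and C: "C > 0" and L: "L > 0"
    and w: "\<And>k. k \<ge> 1 \<Longrightarrow> w k \<ge> 0"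
    and W: "\<And>k. k \<ge> 1 \<Longrightarrow> partial_sum w k > 0"
    and a: "\<And>k. k \<ge> 1 \<Longrightarrow> a k \<ge> 0"
    and u: "\<And>k. k \<ge> 1 \<Longrightarrow> partial_sum w k powr p * a k \<le> u k"
    and uL: "\<And>k. k \<ge> 1 \<Longrightarrow> u k \<le> L * (partial_sum w k powr p * a k)"
    and tail: "\<And>n. 1 \<le> n \<Longrightarrow> n \<le> m \<Longrightarrow>
        partial_sum w n powr p * (\<Sum>k=n..m. a k) \<le> C * (\<Sum>k=1..n. u k)"
    and z0: "\<And>k. k \<ge> 1 \<Longrightarrow> z k \<ge> 0"
    and z: "\<And>k l. 1 \<le> k \<Longrightarrow> k \<le> l \<Longrightarrow> z l \<le> z k"
  shows "(\<Sum>n=1..m. partial_sum (\<lambda>k. z k * w k) n powr p * a n)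
       \<le> hardy_constant p C L * (\<Sum>k=1..m. z k powr p * u k)"
proof -
  define M where "M = max 1 p / min 1 p * (C + 1)"
  define S where "S = partial_sum (\<lambda>k. z k * w k)"
  let ?W = "partial_sum w"
  have M: "M > 0" unfolding M_def using p C by (intro mult_pos_pos divide_pos_pos) auto
  have base: "(\<Sum>n=1..m. S n powr p * a n) \<le> M * (\<Sum>k=1..m. linearizer p w z k * u k)"
    unfolding M_def S_def
    by (rule hardy_sum_le_linearizer_sum[OF p C w W a u tail z0 z])
  show ?thesis
  proof (cases "p \<ge> 1")
    case False
    then show ?thesis using base
      by (simp add: hardy_constant_def linearizer_def M_def S_def Let_def)
  next
    case True
    \<comment> \<open>Chosen so that the term to be absorbed is half of the left side.\<close>
    define \<delta> where "\<delta> = 1 / (2 * M * L)"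
    have \<delta>: "\<delta> > 0" using M L by (simp add: \<delta>_def)
    have pt: "linearizer p w z k * u k
        \<le> \<delta> * L * (S k powr p * a k) + \<delta> powr (1 - p) * (z k powr p * u k)"
      if k: "k \<in> {1..m}" for k
    proof -
      have k1: "k \<ge> 1" using k by simp
      have u0: "u k \<ge> 0"
        using u[OF k1] a[OF k1] by (meson mult_nonneg_nonneg order_trans powr_ge_zero)
      have Sk: "S k \<ge> 0" unfolding S_def by (rule partial_sum_nonneg) (simp add: w z0)
      have "linearizer p w z k
          \<le> \<delta> * (S k / ?W k) powr p + \<delta> powr (1 - p) * z k powr p"
        using True mult_powr_le_weighted_sum[of p "z k" "S k / ?W k" \<delta>] z0[OF k1] Sk W[OF k1] \<delta>
        by (simp add: linearizer_def S_def)
      then have "linearizer p w z k * u k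
          \<le> (\<delta> * (S k / ?W k) powr p + \<delta> powr (1 - p) * z k powr p) * u k"
        using u0 by (intro mult_right_mono)
      also have "\<dots> = \<delta> * ((S k / ?W k) powr p * u k) + \<delta> powr (1 - p) * (z k powr p * u k)"
        by (simp add: algebra_simps)
      also have "(S k / ?W k) powr p * u k \<le> (S k / ?W k) powr p * (L * (?W k powr p * a k))"
        using uL[OF k1] by (intro mult_left_mono) auto
      also have "\<dots> = L * (S k powr p * a k)"
        using W[OF k1] by (simp add: powr_divide)
      finally show ?thesis using \<delta> by (simp add: mult_ac)
    qed
    have "(\<Sum>k=1..m. linearizer p w z k * u k)
        \<le> \<delta> * L * (\<Sum>n=1..m. S n powr p * a n)
          + \<delta> powr (1 - p) * (\<Sum>k=1..m. z k powr p * u k)"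
      unfolding sum_distrib_left sum.distrib[symmetric] by (intro sum_mono pt)
    then have "M * (\<Sum>k=1..m. linearizer p w z k * u k)
        \<le> M * (\<delta> * L * (\<Sum>n=1..m. S n powr p * a n)
          + \<delta> powr (1 - p) * (\<Sum>k=1..m. z k powr p * u k))"
      using M by (intro mult_left_mono) auto
    also have "\<dots> = (\<Sum>n=1..m. S n powr p * a n) / 2
          + M * \<delta> powr (1 - p) * (\<Sum>k=1..m. z k powr p * u k)"
    proof -
      have "M * (\<delta> * L) = 1 / 2" using M L by (simp add: \<delta>_def)
      then show ?thesis by (simp add: distrib_left mult.assoc[symmetric])
    qed
    finally have "(\<Sum>n=1..m. S n powr p * a n)
        \<le> 2 * M * \<delta> powr (1 - p) * (\<Sum>k=1..m. z k powr p * u k)"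
      using base by linarith
    moreover have "hardy_constant p C L = 2 * M * \<delta> powr (1 - p)"
      unfolding hardy_constant_def Let_def M_def[symmetric] \<delta>_def[symmetric] using True by simp
    ultimately show ?thesis unfolding S_def by simp
  qed
qed

section \<open>Comparing the two partial sums\<close>

lemma power_weighted_partial_sum_le:
  assumes "0 \<le> \<beta>" "nonneg_seq \<psi>"
  shows "partial_sum (\<lambda>k. real k powr \<beta> * \<psi> k) n \<le> real n powr \<beta> * partial_sum \<psi> n"
  unfolding partial_sum_def sum_distrib_left
  using assms by (intro sum_mono mult_right_mono powr_mono2) (auto simp: nonneg_seq_def)

text \<open>
  With \<open>m = n div 2\<close> the growth hypothesis at \<open>m\<close> bounds \<open>\<Psi>(m)\<close>, and hence \<open>\<Psi>(n)\<close>, by a multiple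
  of the sum of \<open>\<psi>\<close> over \<open>{m..n}\<close>; on that range \<open>k\<^sup>\<beta> \<ge> (n/3)\<^sup>\<beta>\<close>.
\<close>

lemma power_weighted_partial_sum_ge:
  assumes \<beta>: "0 \<le> \<beta>" and \<psi>: "nonneg_seq \<psi>" and c: "c > 0"
    and growth: "\<And>n. n \<ge> 1 \<Longrightarrow> (\<Sum>k=1..n. \<psi> k) \<le> c * (\<Sum>k=n..2*n. \<psi> k)"
    and n: "n \<ge> 1"
  shows "real n powr \<beta> * partial_sum \<psi> n
       \<le> 3 powr \<beta> * (c + 1) * partial_sum (\<lambda>k. real k powr \<beta> * \<psi> k) n"
proof (cases "n = 1")
  case True
  have "(1::real) \<le> 3 powr \<beta>" using \<beta> by (simp add: ge_one_powr_ge_zero)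
  then have "1 * 1 \<le> 3 powr \<beta> * (c + 1)" using c by (intro mult_mono) auto
  moreover have "\<psi> 1 \<ge> 0" using \<psi> by (simp add: nonneg_seq_def)
  ultimately show ?thesis using True mult_right_mono[of 1 "3 powr \<beta> * (c + 1)" "\<psi> 1"]
    by (simp add: partial_sum_def)
next
  case False
  have \<psi>0: "\<psi> k \<ge> 0" if "k \<ge> 1" for k using \<psi> that by (simp add: nonneg_seq_def)
  define m where "m = n div 2"
  have m: "1 \<le> m" "2 * m \<le> n" "n \<le> 3 * m" "m \<le> n" using n False by (auto simp: m_def)
  define T where "T = (\<Sum>k=m..n. \<psi> k)"
  have "(\<Sum>k=m..2*m. \<psi> k) \<le> T"
    unfolding T_def using m \<psi>0 by (intro sum_mono2) auto
  then have "c * (\<Sum>k=m..2*m. \<psi> k) \<le> c * T"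
    using c by (intro mult_left_mono) auto
  with growth[of m] m have Tm: "(\<Sum>k=1..m. \<psi> k) \<le> c * T" by simp
  have "partial_sum \<psi> n = (\<Sum>k=1..m. \<psi> k) + (\<Sum>k=Suc m..n. \<psi> k)"
    unfolding partial_sum_def using m
    by (subst sum.union_disjoint[symmetric]) (auto intro: sum.cong)
  also have "(\<Sum>k=Suc m..n. \<psi> k) \<le> T"
    unfolding T_def using m \<psi>0 by (intro sum_mono2) auto
  finally have \<Psi>: "partial_sum \<psi> n \<le> (c + 1) * T" using Tm by (simp add: algebra_simps)
  have "real n powr \<beta> \<le> (3 * real m) powr \<beta>" using m \<beta> by (intro powr_mono2) auto
  then have n\<beta>: "real n powr \<beta> \<le> 3 powr \<beta> * real m powr \<beta>" by (simp add: powr_mult)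
  have "real m powr \<beta> * T \<le> (\<Sum>k=m..n. real k powr \<beta> * \<psi> k)"
    unfolding T_def sum_distrib_left using m \<beta> \<psi>0
    by (intro sum_mono mult_right_mono powr_mono2) auto
  also have "\<dots> \<le> partial_sum (\<lambda>k. real k powr \<beta> * \<psi> k) n"
    unfolding partial_sum_def using m \<psi>0 by (intro sum_mono2) auto
  finally have TW: "real m powr \<beta> * T \<le> partial_sum (\<lambda>k. real k powr \<beta> * \<psi> k) n" .
  have T0: "T \<ge> 0" unfolding T_def using m \<psi>0 by (intro sum_nonneg) auto
  have "real n powr \<beta> * partial_sum \<psi> n \<le> (3 powr \<beta> * real m powr \<beta>) * ((c + 1) * T)"
    using n\<beta> \<Psi> partial_sum_nonneg[of \<psi> n] \<psi>0 by (intro mult_mono) auto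
  also have "\<dots> = 3 powr \<beta> * (c + 1) * (real m powr \<beta> * T)" by (simp add: mult_ac)
  also have "\<dots> \<le> 3 powr \<beta> * (c + 1) * partial_sum (\<lambda>k. real k powr \<beta> * \<psi> k) n"
    using TW c by (intro mult_left_mono) auto
  finally show ?thesis .
qed

section \<open>Series with values in the extended half-line\<close>

lemma partial_sums_le_series_from:
  assumes "\<And>k. k \<ge> n \<Longrightarrow> f k \<ge> 0"
  shows "ennreal (\<Sum>k=n..m. f k) \<le> series_from n f"
proof -
  have "ennreal (\<Sum>k=n..m. f k) = (\<Sum>k=n..m. ennreal (f k))"
    by (rule sum_ennreal[symmetric]) (use assms in auto)
  also have "\<dots> = (\<Sum>j<Suc m - n. ennreal (f (n + j)))"
    by (rule sum.reindex_bij_witness[of _ "\<lambda>j. n + j" "\<lambda>k. k - n"]) auto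
  also have "\<dots> \<le> series_from n f"
    unfolding series_from_def by (rule sum_le_suminf) (auto intro: summableI)
  finally show ?thesis .
qed

lemma series_from_1_le:
  assumes f: "\<And>k. k \<ge> 1 \<Longrightarrow> f k \<ge> 0"
    and le: "\<And>m. ennreal (\<Sum>k=1..m. f k) \<le> B"
  shows "series_from 1 f \<le> B"
  unfolding series_from_def
proof (rule suminf_le_const)
  fix m
  have "(\<Sum>j<m. ennreal (f (1 + j))) = (\<Sum>k=1..m. ennreal (f k))"
    by (rule sum.reindex_bij_witness[of _ "\<lambda>k. k - 1" "\<lambda>j. 1 + j"]) auto
  also have "\<dots> = ennreal (\<Sum>k=1..m. f k)"
    by (rule sum_ennreal) (use f in auto)
  finally show "(\<Sum>j<m. ennreal (f (1 + j))) \<le> B" using le[of m] by simp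
qed (auto intro: summableI)

section \<open>Characterization of the Hardy inequality\<close>

lemma hardy_avg_powr:
  "hardy_avg \<psi> y n powr p
       = partial_sum (\<lambda>k. y k * \<psi> k) n powr p * partial_sum \<psi> n powr (- p)"
proof -
  have "hardy_avg \<psi> y n = partial_sum (\<lambda>k. y k * \<psi> k) n / partial_sum \<psi> n"
    by (simp add: hardy_avg_def partial_sum_def)
  then show ?thesis by (simp add: powr_divide powr_minus_divide)
qed

text \<open>
  The test sequence \<open>k\<^sup>\<beta>\<close> on \<open>{1..n}\<close>, extended by zero, has the same numerator in all its
  averages from \<open>n\<close> on.
\<close>

lemma hardy_inequality_imp_weight_condition:
  fixes p \<beta> C :: real and \<psi> v :: "nat \<Rightarrow> real"
  assumes v: "nonneg_seq v"
    and C: "C > 0"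
    and hardy: "\<And>y. nonneg_seq y \<Longrightarrow> y \<in> quasi_nonincreasing \<beta> \<Longrightarrow>
              series_from 1 (\<lambda>n. hardy_avg \<psi> y n powr p * v n)
                \<le> ennreal C * series_from 1 (\<lambda>n. y n powr p * v n)"
    and n: "n \<ge> 1"
  shows "ennreal ((\<Sum>k=1..n. real k powr \<beta> * \<psi> k) powr p)
            * series_from n (\<lambda>k. partial_sum \<psi> k powr (- p) * v k)
         \<le> ennreal (C * (\<Sum>k=1..n. real k powr (\<beta> * p) * v k))"
proof -
  define y where "y k = (if k \<le> n then real k powr \<beta> else 0)" for k
  define B where "B = (\<Sum>k=1..n. real k powr \<beta> * \<psi> k)"
  have v0: "v k \<ge> 0" if "k \<ge> 1" for k using v that by (simp add: nonneg_seq_def)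
  have y0: "nonneg_seq y" by (simp add: nonneg_seq_def y_def)
  have "real k powr - \<beta> * y k = (if k \<le> n then 1 else 0)" if "k \<ge> 1" for k
    using that by (simp add: y_def powr_minus)
  then have yQ: "y \<in> quasi_nonincreasing \<beta>"
    unfolding quasi_nonincreasing_def by (auto intro!: monotone_onI)
  have Sy: "partial_sum (\<lambda>k. y k * \<psi> k) k = B" if "k \<ge> n" for k
  proof -
    have "(\<Sum>\<tau>=1..k. y \<tau> * \<psi> \<tau>) = (\<Sum>\<tau>=1..n. y \<tau> * \<psi> \<tau>)"
      using that by (intro sum.mono_neutral_right) (auto simp: y_def)
    then show ?thesis by (simp add: partial_sum_def B_def y_def)
  qed
  define F where "F k = hardy_avg \<psi> y k powr p * v k" for k
  have F0: "F k \<ge> 0" if "k \<ge> 1" for k using v0[OF that] by (simp add: F_def)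
  have "ennreal (B powr p) * series_from n (\<lambda>k. partial_sum \<psi> k powr (- p) * v k)
      = (\<Sum>j. ennreal (F (n + j)))"
  proof -
    have "ennreal (B powr p) * ennreal (partial_sum \<psi> (n + j) powr (- p) * v (n + j))
        = ennreal (F (n + j))" for j
      using Sy[of "n + j"]
      by (simp add: F_def hardy_avg_powr ennreal_mult'[symmetric] mult.assoc)
    then show ?thesis
      unfolding series_from_def by (simp flip: ennreal_suminf_cmult)
  qed
  also have "\<dots> \<le> series_from 1 F"
  proof (rule suminf_le_const)
    fix l
    have "(\<Sum>j<l. ennreal (F (n + j))) = (\<Sum>k=n..<n+l. ennreal (F k))"
      by (rule sum.reindex_bij_witness[of _ "\<lambda>k. k - n" "\<lambda>j. n + j"]) auto
    also have "\<dots> \<le> (\<Sum>k=1..n+l. ennreal (F k))"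
      using n by (intro sum_mono2) auto
    also have "\<dots> = ennreal (\<Sum>k=1..n+l. F k)"
      by (rule sum_ennreal) (use F0 in auto)
    also have "\<dots> \<le> series_from 1 F" using F0 by (intro partial_sums_le_series_from) auto
    finally show "(\<Sum>j<l. ennreal (F (n + j))) \<le> series_from 1 F" .
  qed (auto intro: summableI)
  also have "\<dots> \<le> ennreal C * series_from 1 (\<lambda>n. y n powr p * v n)"
    unfolding F_def by (rule hardy[OF y0 yQ])
  also have "\<dots> \<le> ennreal C * ennreal (\<Sum>k=1..n. real k powr (\<beta> * p) * v k)"
  proof (intro mult_left_mono series_from_1_le)
    fix m
    have "(\<Sum>k=1..m. y k powr p * v k) \<le> (\<Sum>k=1..n+m. y k powr p * v k)"
      using v0 by (intro sum_mono2) auto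
    also have "\<dots> = (\<Sum>k=1..n. y k powr p * v k)"
      by (intro sum.mono_neutral_right) (auto simp: y_def)
    also have "\<dots> = (\<Sum>k=1..n. real k powr (\<beta> * p) * v k)"
      by (intro sum.cong) (auto simp: y_def powr_powr)
    finally show "ennreal (\<Sum>k=1..m. y k powr p * v k)
        \<le> ennreal (\<Sum>k=1..n. real k powr (\<beta> * p) * v k)"
      by (rule ennreal_leI)
  qed (use v0 in auto)
  also have "\<dots> = ennreal (C * (\<Sum>k=1..n. real k powr (\<beta> * p) * v k))"
    using C by (simp add: ennreal_mult')
  finally show ?thesis unfolding B_def .
qed

lemma weight_condition_imp_hardy_inequality:
  fixes p \<beta> c C :: real and \<psi> v y :: "nat \<Rightarrow> real"
  assumes p: "0 < p" and \<beta>: "0 \<le> \<beta>"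
    and \<psi>: "nonneg_seq \<psi>"
    and \<Psi>: "\<And>k. k \<ge> 1 \<Longrightarrow> 0 < partial_sum \<psi> k"
    and c: "c > 0"
    and growth: "\<And>n. n \<ge> 1 \<Longrightarrow> (\<Sum>k=1..n. \<psi> k) \<le> c * (\<Sum>k=n..2*n. \<psi> k)"
    and v: "nonneg_seq v"
    and C: "C > 0"
    and cond: "\<And>n. n \<ge> 1 \<Longrightarrow>
        ennreal ((\<Sum>k=1..n. real k powr \<beta> * \<psi> k) powr p)
            * series_from n (\<lambda>k. partial_sum \<psi> k powr (- p) * v k)
         \<le> ennreal (C * (\<Sum>k=1..n. real k powr (\<beta> * p) * v k))"
    and y: "nonneg_seq y" "y \<in> quasi_nonincreasing \<beta>"
  shows "series_from 1 (\<lambda>n. hardy_avg \<psi> y n powr p * v n)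
       \<le> ennreal (hardy_constant p C ((3 powr \<beta> * (c + 1)) powr p))
           * series_from 1 (\<lambda>n. y n powr p * v n)"
proof -
  define w where "w k = real k powr \<beta> * \<psi> k" for k
  define z where "z k = real k powr (- \<beta>) * y k" for k
  define a where "a k = partial_sum \<psi> k powr (- p) * v k" for k
  define u where "u k = real k powr (\<beta> * p) * v k" for k
  define L where "L = (3 powr \<beta> * (c + 1)) powr p"
  define K where "K = hardy_constant p C L"
  have v0: "v k \<ge> 0" if "k \<ge> 1" for k using v that by (simp add: nonneg_seq_def)
  have w0: "w k \<ge> 0" if "k \<ge> 1" for k using \<psi> that by (simp add: nonneg_seq_def w_def)
  have a0: "a k \<ge> 0" if "k \<ge> 1" for k using v0[OF that] by (simp add: a_def)
  have z0: "z k \<ge> 0" if "k \<ge> 1" for k using y that by (simp add: nonneg_seq_def z_def)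
  have z: "z l \<le> z k" if "1 \<le> k" "k \<le> l" for k l
    using y(2) that unfolding quasi_nonincreasing_def z_def
    by (auto dest!: monotone_onD[where x = k and y = l])
  have W_eq: "partial_sum (\<lambda>k. real k powr \<beta> * \<psi> k) = partial_sum w"
    by (simp add: w_def[abs_def])
  have W_le: "partial_sum w k \<le> real k powr \<beta> * partial_sum \<psi> k" for k
    using power_weighted_partial_sum_le[OF \<beta> \<psi>] by (simp add: W_eq)
  have W_ge: "real k powr \<beta> * partial_sum \<psi> k \<le> 3 powr \<beta> * (c + 1) * partial_sum w k"
    if "k \<ge> 1" for k
    using power_weighted_partial_sum_ge[OF \<beta> \<psi> c growth that] by (simp add: W_eq)
  have L: "L > 0" using c by (simp add: L_def)
  have W: "partial_sum w k > 0" if "k \<ge> 1" for k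
  proof -
    have "0 < real k powr \<beta> * partial_sum \<psi> k" using \<Psi>[OF that] that by simp
    then have "0 < 3 powr \<beta> * (c + 1) * partial_sum w k" using W_ge[OF that] by linarith
    moreover have "0 < 3 powr \<beta> * (c + 1)" using c by simp
    ultimately show ?thesis by (rule zero_less_mult_pos)
  qed
  have u_alt: "u k = (real k powr \<beta> * partial_sum \<psi> k) powr p * a k" if "k \<ge> 1" for k
    using \<Psi>[OF that] by (simp add: u_def a_def powr_mult powr_powr powr_minus)
  have u_ge: "partial_sum w k powr p * a k \<le> u k" if "k \<ge> 1" for k
    unfolding u_alt[OF that] using W_le[of k] W[OF that] a0[OF that] p
    by (intro mult_right_mono powr_mono2) auto
  have u_le: "u k \<le> L * (partial_sum w k powr p * a k)" if "k \<ge> 1" for k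
  proof -
    have "u k \<le> (3 powr \<beta> * (c + 1) * partial_sum w k) powr p * a k"
      unfolding u_alt[OF that] using W_ge[OF that] \<Psi>[OF that] a0[OF that] p
      by (intro mult_right_mono powr_mono2) auto
    then show ?thesis by (simp add: L_def powr_mult mult_ac)
  qed
  have u0: "u k \<ge> 0" if "k \<ge> 1" for k using v0[OF that] by (simp add: u_def)
  have tail: "partial_sum w n powr p * (\<Sum>k=n..m. a k) \<le> C * (\<Sum>k=1..n. u k)" if "n \<ge> 1" for n m
  proof -
    have "ennreal (partial_sum w n powr p * (\<Sum>k=n..m. a k))
        = ennreal (partial_sum w n powr p) * ennreal (\<Sum>k=n..m. a k)"
      by (simp add: ennreal_mult')
    also have "\<dots> \<le> ennreal (partial_sum w n powr p) * series_from n a"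
      using a0 that by (intro mult_left_mono partial_sums_le_series_from) auto
    also have "\<dots> \<le> ennreal (C * (\<Sum>k=1..n. u k))"
      using cond[OF that] by (simp add: w_def a_def[abs_def] u_def partial_sum_def)
    finally show ?thesis
      using C u0 by (subst (asm) ennreal_le_iff) (auto intro!: mult_nonneg_nonneg sum_nonneg)
  qed
  have y_eq: "y k = real k powr \<beta> * z k" if "k \<ge> 1" for k
    using that by (simp add: z_def powr_minus)
  have S_eq: "partial_sum (\<lambda>k. y k * \<psi> k) n = partial_sum (\<lambda>k. z k * w k) n" for n
    unfolding partial_sum_def by (intro sum.cong) (auto simp: w_def y_eq)
  have K: "K > 0" unfolding K_def using p C L by (rule hardy_constant_pos)
  have "series_from 1 (\<lambda>n. hardy_avg \<psi> y n powr p * v n)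
      \<le> ennreal K * series_from 1 (\<lambda>n. y n powr p * v n)"
  proof (rule series_from_1_le)
    fix m
    have "(\<Sum>n=1..m. hardy_avg \<psi> y n powr p * v n)
        = (\<Sum>n=1..m. partial_sum (\<lambda>k. z k * w k) n powr p * a n)"
      by (simp add: hardy_avg_powr S_eq a_def mult.assoc)
    also have "\<dots> \<le> K * (\<Sum>k=1..m. z k powr p * u k)"
      unfolding K_def
      by (rule finite_hardy_inequality[OF p C L w0 W a0 u_ge u_le tail z0 z])
    also have "(\<Sum>k=1..m. z k powr p * u k) = (\<Sum>k=1..m. y k powr p * v k)"
      by (intro sum.cong) (auto simp: y_eq u_def powr_mult powr_powr)
    finally have "ennreal (\<Sum>n=1..m. hardy_avg \<psi> y n powr p * v n)
        \<le> ennreal (K * (\<Sum>k=1..m. y k powr p * v k))"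
      by (rule ennreal_leI)
    also have "\<dots> = ennreal K * ennreal (\<Sum>k=1..m. y k powr p * v k)"
      using K by (simp add: ennreal_mult')
    also have "\<dots> \<le> ennreal K * series_from 1 (\<lambda>n. y n powr p * v n)"
      using v0 by (intro mult_left_mono partial_sums_le_series_from) auto
    finally show "ennreal (\<Sum>n=1..m. hardy_avg \<psi> y n powr p * v n)
        \<le> ennreal K * series_from 1 (\<lambda>n. y n powr p * v n)" .
  qed (use v0 in auto)
  then show ?thesis by (simp add: K_def L_def)
qed

theorem theorem2p5:
  fixes p \<beta> :: real and \<psi> v :: "nat \<Rightarrow> real"
  assumes "0 < p" and "0 \<le> \<beta>"
    and "nonneg_seq \<psi>"
    and "\<forall>k\<ge>1. 0 < partial_sum \<psi> k"
    and "\<exists>c>0. \<forall>n\<ge>1. (\<Sum>k=1..n. \<psi> k) \<le> c * (\<Sum>k=n..2*n. \<psi> k)"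
    and "nonneg_seq v"
  shows "(\<exists>C::real. C > 0 \<and>
            (\<forall>y. nonneg_seq y \<and> y \<in> quasi_nonincreasing \<beta> \<longrightarrow>
              series_from 1 (\<lambda>n. hardy_avg \<psi> y n powr p * v n)
                \<le> ennreal C * series_from 1 (\<lambda>n. y n powr p * v n)))
     \<longleftrightarrow>
         (\<exists>C::real. C > 0 \<and>
            (\<forall>n\<ge>1.
              ennreal ((\<Sum>k=1..n. real k powr \<beta> * \<psi> k) powr p)
                  * series_from n (\<lambda>k. partial_sum \<psi> k powr (- p) * v k)
                \<le> ennreal (C * (\<Sum>k=1..n. real k powr (\<beta> * p) * v k))))"
proof
  assume "\<exists>C::real. C > 0 \<and>
            (\<forall>y. nonneg_seq y \<and> y \<in> quasi_nonincreasing \<beta> \<longrightarrow>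
              series_from 1 (\<lambda>n. hardy_avg \<psi> y n powr p * v n)
                \<le> ennreal C * series_from 1 (\<lambda>n. y n powr p * v n))"
  then obtain C where "C > 0" and "\<And>y. nonneg_seq y \<Longrightarrow> y \<in> quasi_nonincreasing \<beta> \<Longrightarrow>
              series_from 1 (\<lambda>n. hardy_avg \<psi> y n powr p * v n)
                \<le> ennreal C * series_from 1 (\<lambda>n. y n powr p * v n)"
    by blast
  then show "\<exists>C::real. C > 0 \<and>
            (\<forall>n\<ge>1.
              ennreal ((\<Sum>k=1..n. real k powr \<beta> * \<psi> k) powr p)
                  * series_from n (\<lambda>k. partial_sum \<psi> k powr (- p) * v k)
                \<le> ennreal (C * (\<Sum>k=1..n. real k powr (\<beta> * p) * v k)))"
    using hardy_inequality_imp_weight_condition[OF assms(6)] by blast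
next
  assume "\<exists>C::real. C > 0 \<and>
            (\<forall>n\<ge>1.
              ennreal ((\<Sum>k=1..n. real k powr \<beta> * \<psi> k) powr p)
                  * series_from n (\<lambda>k. partial_sum \<psi> k powr (- p) * v k)
                \<le> ennreal (C * (\<Sum>k=1..n. real k powr (\<beta> * p) * v k)))"
  then obtain C where C: "C > 0" and cond: "\<And>n. n \<ge> 1 \<Longrightarrow>
              ennreal ((\<Sum>k=1..n. real k powr \<beta> * \<psi> k) powr p)
                  * series_from n (\<lambda>k. partial_sum \<psi> k powr (- p) * v k)
                \<le> ennreal (C * (\<Sum>k=1..n. real k powr (\<beta> * p) * v k))"
    by blast
  obtain c where c: "c > 0" "\<And>n. n \<ge> 1 \<Longrightarrow> (\<Sum>k=1..n. \<psi> k) \<le> c * (\<Sum>k=n..2*n. \<psi> k)"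
    using assms(5) by blast
  have \<Psi>: "\<And>k. k \<ge> 1 \<Longrightarrow> 0 < partial_sum \<psi> k" using assms(4) by blast
  have "hardy_constant p C ((3 powr \<beta> * (c + 1)) powr p) > 0"
    using assms(1) C c(1) by (intro hardy_constant_pos) auto
  then show "\<exists>C::real. C > 0 \<and>
            (\<forall>y. nonneg_seq y \<and> y \<in> quasi_nonincreasing \<beta> \<longrightarrow>
              series_from 1 (\<lambda>n. hardy_avg \<psi> y n powr p * v n)
                \<le> ennreal C * series_from 1 (\<lambda>n. y n powr p * v n))"
    using weight_condition_imp_hardy_inequality[OF assms(1-3) \<Psi> c assms(6) C cond] by blast
qed

end
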